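(* Let $K(x)=\dfrac{(x_2,-x_1)}{2\pi|x|^2}$ for $x\in\mathbb R^2\setminus\{0\}$. Let $(\omega,\theta)$ be a smooth solution on $[0,S]\times\mathbb R^2$ of $$\omega_s+v\cdot\nabla\omega=\partial_2\theta,\qquad \theta_s+v\cdot\nabla\theta=0,\qquad v=K*\omega-(K*\omega)(0),$$ with initial data $(\omega_0,\theta_0)$ such that $\omega_0$ and $\nabla\theta_0$ are supported in the ball $B_8=\{|b|\le 8\}\subset\mathbb R^2$. Let $Q(s,\cdot)$ be the (area-preserving) material map, $Q_s(s,a)=v(s,Q(s,a))$, $Q(0,a)=a$, and let $B$ be defined by $B_s=Q_1$, $B(0,\cdot)=0$, where $Q_1$ is the first component of $Q$. Then for all $s\in[0,S]$ and $a\in\mathbb R^2$, $$\theta(s,Q(s,a))=\theta_0(a),\qquad \zeta(s,a):=\omega(s,Q(s,a))=\omega_0(a)+\{B(s,\cdot),\theta_0\}(a),$$ and $(Q,B)$ satisfies the closed system $$Q_s(s,a)=\int_{B_8}\big[K(Q(s,a)-Q(s,b))-K(-Q(s,b))\big]\,\big[\omega_0(b)+\{B(s,\cdot),\theta_0\}(b)\big]\,db,\qquad B_s=Q_1 .$$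
   Context: The Poisson bracket in the label variable $a=(a_1,a_2)$ is $\{f,g\}=\partial_{a_1}f\,\partial_{a_2}g-\partial_{a_2}f\,\partial_{a_1}g$. Here $(K*\omega)(0)$ is the value of $K*\omega(s,\cdot)$ at the origin, a function of $s$ only. Area-preserving means $\det D_aQ(s,a)=1$. *)

theory Defs
  imports "HOL-Analysis.Analysis"
begin

text \<open>Differentiability is taken within \<open>A\<close>, so that for a closed slab \<open>A\<close>, such as
  \<open>{0..S} \<times> UNIV\<close>, the derivatives are one-sided on the boundary and smoothness
  holds up to the boundary.\<close>

primrec Ck_on :: "nat \<Rightarrow> 'a::real_normed_vector set \<Rightarrow> ('a \<Rightarrow> 'b::real_normed_vector) \<Rightarrow> bool" where
  "Ck_on 0 A f \<longleftrightarrow> continuous_on A f"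
| "Ck_on (Suc k) A f \<longleftrightarrow>
     (\<exists>f'. (\<forall>x\<in>A. (f has_derivative f' x) (at x within A)) \<and> (\<forall>h. Ck_on k A (\<lambda>x. f' x h)))"

definition smooth_on :: "'a::real_normed_vector set \<Rightarrow> ('a \<Rightarrow> 'b::real_normed_vector) \<Rightarrow> bool" where
  "smooth_on A f \<longleftrightarrow> (\<forall>k. Ck_on k A f)"

definition partial :: "2 \<Rightarrow> (real^2 \<Rightarrow> real) \<Rightarrow> real^2 \<Rightarrow> real" where
  "partial i f x = deriv (\<lambda>t. f (x + t *\<^sub>R axis i 1)) 0"

definition grad :: "(real^2 \<Rightarrow> real) \<Rightarrow> real^2 \<Rightarrow> real^2" where
  "grad f x = vector [partial 1 f x, partial 2 f x]"

definition poisson_bracket :: "(real^2 \<Rightarrow> real) \<Rightarrow> (real^2 \<Rightarrow> real) \<Rightarrow> real^2 \<Rightarrow> real" where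
  "poisson_bracket f g a = partial 1 f a * partial 2 g a - partial 2 f a * partial 1 g a"

text \<open>The Biot--Savart kernel; its value at the origin (here \<open>0\<close>) is irrelevant.\<close>

definition K :: "real^2 \<Rightarrow> real^2" where
  "K x = (1 / (2 * pi * (norm x)\<^sup>2)) *\<^sub>R vector [x $ 2, - (x $ 1)]"

definition K_conv :: "(real^2 \<Rightarrow> real) \<Rightarrow> real^2 \<Rightarrow> real^2" where
  "K_conv w x = (LINT y|lborel. w y *\<^sub>R K (x - y))"

definition velocity :: "(real \<Rightarrow> real^2 \<Rightarrow> real) \<Rightarrow> real \<Rightarrow> real^2 \<Rightarrow> real^2" where
  "velocity \<omega> s x = K_conv (\<omega> s) x - K_conv (\<omega> s) 0"

text \<open>Smooth solutions on \<open>[0,S] \<times> \<real>\<^sup>2\<close>. Smoothness alone does not give a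
  meaning to the convolution with \<open>K\<close>; the second condition, the vorticity lies in
  \<open>L\<^sup>\<infinity>([0,S]; L\<^sup>1 \<inter> L\<^sup>\<infinity>)\<close>, makes the Biot--Savart integral absolutely
  convergent and bounded.\<close>

definition smooth_solution ::
  "real \<Rightarrow> (real \<Rightarrow> real^2 \<Rightarrow> real) \<Rightarrow> (real \<Rightarrow> real^2 \<Rightarrow> real) \<Rightarrow> bool" where
  "smooth_solution S \<omega> \<theta> \<longleftrightarrow>
     smooth_on ({0..S} \<times> UNIV) (\<lambda>(s, x). \<omega> s x) \<and>
     smooth_on ({0..S} \<times> UNIV) (\<lambda>(s, x). \<theta> s x) \<and>
     (\<exists>M. \<forall>s\<in>{0..S}. (\<forall>x. \<bar>\<omega> s x\<bar> \<le> M) \<and>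
        integrable lborel (\<omega> s) \<and> (LINT x|lborel. \<bar>\<omega> s x\<bar>) \<le> M) \<and>
     (\<forall>s\<in>{0..S}. \<forall>x.
        vector_derivative (\<lambda>r. \<omega> r x) (at s within {0..S}) + velocity \<omega> s x \<bullet> grad (\<omega> s) x
          = partial 2 (\<theta> s) x \<and>
        vector_derivative (\<lambda>r. \<theta> r x) (at s within {0..S}) + velocity \<omega> s x \<bullet> grad (\<theta> s) x
          = 0)"

definition material_map ::
  "real \<Rightarrow> (real \<Rightarrow> real^2 \<Rightarrow> real^2) \<Rightarrow> (real \<Rightarrow> real^2 \<Rightarrow> real^2) \<Rightarrow> bool" where
  "material_map S v Q \<longleftrightarrow>
     (\<forall>a. Q 0 a = a) \<and>
     (\<forall>s\<in>{0..S}. \<forall>a. ((\<lambda>r. Q r a) has_vector_derivative v s (Q s a)) (at s within {0..S}))"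

definition area_preserving :: "(real^2 \<Rightarrow> real^2) \<Rightarrow> bool" where
  "area_preserving q \<longleftrightarrow> (\<forall>a. q differentiable (at a) \<and> det (jacobian q (at a)) = 1)"

end

theory Submission
  imports Defs
begin

text \<open>
  Along particle paths \<open>\<theta>\<close> is constant and \<open>\<omega>\<close> changes at the rate \<open>\<partial>\<^sub>2\<theta>\<close>. Differentiating
  \<open>\<theta>(s, Q(s, a)) = \<theta>0(a)\<close> in the label \<open>a\<close> expresses \<open>\<nabla>\<theta>0\<close> through \<open>DQ\<close> and \<open>\<nabla>\<theta>\<close> at \<open>Q\<close>;
  because \<open>det DQ = 1\<close>, Cramer's rule inverts this relation to \<open>\<partial>\<^sub>2\<theta>(s, Q) = {Q\<^sub>1, \<theta>0}\<close>
  (\<open>partial_2_eq_bracket\<close>). The bracket is linear in its first argument and \<open>\<theta>0\<close> does not depend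
  on time, so integrating in \<open>s\<close> turns \<open>Q\<^sub>1\<close> into \<open>B\<close> and gives the formula for the vorticity.
  That formula vanishes for labels outside the ball of radius 8, and the area-preserving
  substitution \<open>y = Q(s, b)\<close> in the Biot--Savart integral yields the closed system.

  The analytic content is what makes these steps legitimate. Integrating the bracket requires
  \<open>B(s, \<cdot>)\<close> to be differentiable with \<open>DB\<close> the time integral of \<open>DQ\<^sub>1\<close>, hence a bound on \<open>DQ\<close>
  that is uniform in time; the substitution requires \<open>Q(s, \<cdot>)\<close> to be a bijection of the plane.
  Both follow from two estimates on the velocity that are uniform in
  time: it is bounded (\<open>velocity_bounded\<close>) and Lipschitz on every ball
  (\<open>velocity_locally_Lipschitz\<close>). By Gronwall's inequality, run forwards and backwards, the
  Lipschitz bound makes \<open>Q(s, \<cdot>)\<close> bi-Lipschitz on balls (\<open>flow_bilipschitz\<close>). This gives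
  injectivity, and it supplies the domination needed to differentiate under the time integral
  (\<open>has_derivative_integral_Lipschitz\<close>). The bound
  on the velocity gives \<open>\<bar>Q(s, a) - a\<bar> \<le> C\<close>, and a continuous map of the plane at bounded distance from
  the identity is onto by Brouwer's theorem (\<open>surj_bounded_displacement\<close>).
\<close>

section \<open>The Biot--Savart kernel\<close>

lemma norm_vec2: "(norm (x::real^2))\<^sup>2 = (x$1)\<^sup>2 + (x$2)\<^sup>2"
  by (simp add: norm_vec_def L2_set_def sum_2)

lemma K_nth: "K x $ 1 = x$2 / (norm x)\<^sup>2 / (2*pi)" "K x $ 2 = - (x$1 / (norm x)\<^sup>2 / (2*pi))"
  by (simp_all add: K_def)

lemma norm_K: "norm (K x) = 1 / (2*pi*norm x)"
proof (cases "x = 0")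
  case False
  have "norm (vector [x $ 2, - (x $ 1)] :: real^2) = norm x"
    by (rule power2_eq_imp_eq) (simp_all add: norm_vec2)
  then show ?thesis using False by (simp add: K_def power2_eq_square)
qed (simp add: K_def)

text \<open>Up to a rotation and the factor \<open>2\<pi>\<close>, \<open>K\<close> is the inversion \<open>x / \<bar>x\<bar>\<^sup>2\<close>, which satisfies this
  distance identity exactly. Unlike a derivative bound, it holds
  also when the segment from \<open>x\<close> to \<open>y\<close> passes through the singularity.\<close>

lemma norm_K_diff:
  assumes "x \<noteq> 0" "y \<noteq> 0"
  shows "norm (K x - K y) = norm (x - y) / (2*pi*norm x*norm y)"
proof (rule power2_eq_imp_eq)
  define p q where "p = (x$1)\<^sup>2 + (x$2)\<^sup>2" and "q = (y$1)\<^sup>2 + (y$2)\<^sup>2"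
  have n: "(norm x)\<^sup>2 = p" "(norm y)\<^sup>2 = q" by (simp_all add: norm_vec2 p_def q_def)
  then have pos: "p \<noteq> 0" "q \<noteq> 0" using assms by auto
  have "(norm (K x - K y))\<^sup>2 = (x$2/p/(2*pi) - y$2/q/(2*pi))\<^sup>2 + (y$1/q/(2*pi) - x$1/p/(2*pi))\<^sup>2"
    unfolding norm_vec2[of "K x - K y"] by (simp add: K_nth n)
  also have "\<dots> = ((x$2/p - y$2/q)\<^sup>2 + (y$1/q - x$1/p)\<^sup>2)/(2*pi)\<^sup>2"
    by (simp only: diff_divide_distrib[symmetric] add_divide_distrib[symmetric] power_divide)
  also have "(x$2/p - y$2/q)\<^sup>2 + (y$1/q - x$1/p)\<^sup>2
      = ((x$1)\<^sup>2 + (x$2)\<^sup>2)/p\<^sup>2 + ((y$1)\<^sup>2 + (y$2)\<^sup>2)/q\<^sup>2 - 2*(x$1*y$1 + x$2*y$2)/(p*q)"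
    using pos by (simp add: power2_diff power_divide add_divide_distrib ring_distribs mult.commute mult.left_commute)
  also have "\<dots> = p/p\<^sup>2 + q/q\<^sup>2 - 2*(x$1*y$1 + x$2*y$2)/(p*q)"
    by (simp add: p_def q_def)
  also have "\<dots> = (p + q - 2*(x$1*y$1 + x$2*y$2))/(p*q)"
    using pos by (simp add: power2_eq_square field_simps)
  also have "p + q - 2*(x$1*y$1 + x$2*y$2) = (norm (x - y))\<^sup>2"
    unfolding norm_vec2 p_def q_def by (simp add: power2_eq_square algebra_simps)
  finally show "(norm (K x - K y))\<^sup>2 = (norm (x - y) / (2*pi*norm x*norm y))\<^sup>2"
    by (simp add: power_divide power_mult_distrib n)
qed auto

lemma K_measurable [measurable]: "K \<in> borel_measurable borel"
proof -
  have "K = (\<lambda>x. (1 / (2 * pi * (norm x)\<^sup>2)) *\<^sub>R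
              ((x \<bullet> axis 2 1) *\<^sub>R axis 1 1 - (x \<bullet> axis 1 1) *\<^sub>R axis 2 1))"
    by (simp add: fun_eq_iff K_def vec_eq_iff forall_2 inner_axis) (simp add: axis_def)
  then show ?thesis
    by (rule ssubst) measurable
qed

text \<open>One-dimensional factor of a product that dominates \<open>\<bar>K\<bar>\<close>.\<close>

lemma nn_integral_inv_sqrt_finite:
  assumes "0 \<le> r"
  shows "(\<integral>\<^sup>+t. ennreal (indicator {-r..r} t * \<bar>t\<bar> powr (-1/2)) \<partial>lborel) < \<infinity>"
proof -
  define I where "I = (\<integral>\<^sup>+t. ennreal (indicator {0..r} t * \<bar>t\<bar> powr (-1/2)) \<partial>lborel)"
  have "((\<lambda>t::real. t powr (-1/2)) has_integral (r powr (-1/2+1) / (-1/2+1))) {0..r}"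
    using assms by (intro has_integral_powr_from_0) auto
  from nn_integral_has_integral_lebesgue[OF _ this]
  have "(\<integral>\<^sup>+t. ennreal (indicator {0..r} t * t powr (-1/2)) \<partial>lborel) < \<infinity>"
    by simp
  also have "(\<integral>\<^sup>+t. ennreal (indicator {0..r} t * t powr (-1/2)) \<partial>lborel) = I"
    unfolding I_def by (intro nn_integral_cong) (auto simp: indicator_def)
  finally have I: "I < \<infinity>" .
  have "I = (\<integral>\<^sup>+t. ennreal (indicator {0..r} (-t) * \<bar>t\<bar> powr (-1/2)) \<partial>lborel)"
    unfolding I_def
    by (subst nn_integral_real_affine[where c="-1" and t=0]) auto
  then have "I + I = (\<integral>\<^sup>+t. ennreal (indicator {0..r} t * \<bar>t\<bar> powr (-1/2))
      + ennreal (indicator {0..r} (-t) * \<bar>t\<bar> powr (-1/2)) \<partial>lborel)"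
    by (subst nn_integral_add) (auto simp: I_def)
  moreover have "(\<integral>\<^sup>+t. ennreal (indicator {-r..r} t * \<bar>t\<bar> powr (-1/2)) \<partial>lborel) \<le> \<dots>"
    by (intro nn_integral_mono) (auto simp: indicator_def)
  ultimately show ?thesis using I by (metis ennreal_add_less_top infinity_ennreal_def le_less_trans)
qed

lemma prod_Basis_2: "(\<Prod>b\<in>Basis. g ((x::real^2) \<bullet> b)) = g (x$1) * g (x$2)"
proof -
  have B: "Basis = {axis 1 1, axis 2 1 :: real^2}"
    by (auto simp: Basis_vec_def UNIV_2)
  have "axis 1 1 \<noteq> (axis 2 1 :: real^2)" by (simp add: axis_eq_axis)
  then show ?thesis unfolding B by (simp add: inner_axis)
qed

text \<open>Since \<open>\<bar>z\<^sub>1\<bar>\<close> and \<open>\<bar>z\<^sub>2\<bar>\<close> are at most \<open>\<bar>z\<bar>\<close>, one has \<open>1 / \<bar>z\<bar> \<le> \<bar>z\<^sub>1\<bar>\<^sup>-\<^sup>1\<^sup>/\<^sup>2 \<bar>z\<^sub>2\<bar>\<^sup>-\<^sup>1\<^sup>/\<^sup>2\<close> off the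
  axes. The right-hand side is a product of integrable functions of one variable, so Tonelli's
  theorem gives integrability over a square.\<close>

lemma set_integrable_K_cball: "set_integrable lborel (cball 0 r) K"
proof (cases "0 \<le> r")
  case True
  define f where "f t = ennreal (indicator {-r..r} t * \<bar>t\<bar> powr (-1/2))" for t
  have le: "ennreal (norm (indicat_real (cball 0 r) z *\<^sub>R K z)) \<le> (\<Prod>b\<in>Basis. f (z \<bullet> b))"
    if nz: "z$1 \<noteq> 0" "z$2 \<noteq> 0" for z :: "real^2"
  proof (cases "z \<in> cball 0 r")
    case z: True
    have c: "\<bar>z$1\<bar> \<le> norm z" "\<bar>z$2\<bar> \<le> norm z" by (simp_all add: component_le_norm_cart)
    have i: "z$1 \<in> {-r..r}" "z$2 \<in> {-r..r}" using z c by auto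
    have "z \<noteq> 0" using nz by auto
    have "\<bar>z$1\<bar> powr (1/2) * \<bar>z$2\<bar> powr (1/2) \<le> norm z powr (1/2) * norm z powr (1/2)"
      using c by (intro mult_mono powr_mono2) auto
    also have "\<dots> = norm z" using \<open>z \<noteq> 0\<close> by (simp add: powr_add[symmetric])
    also have "\<dots> \<le> 2*pi*norm z" using mult_right_mono[of 1 "2*pi" "norm z"] pi_gt3 by simp
    finally have "1 / (2*pi*norm z) \<le> 1 / (\<bar>z$1\<bar> powr (1/2) * \<bar>z$2\<bar> powr (1/2))"
      using nz \<open>z \<noteq> 0\<close> by (intro divide_left_mono mult_pos_pos) auto
    also have "\<dots> = \<bar>z$1\<bar> powr (-1/2) * \<bar>z$2\<bar> powr (-1/2)"
      by (simp add: powr_minus_divide)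
    finally show ?thesis
      unfolding prod_Basis_2[of f z] unfolding f_def using z i
      by (simp add: norm_K ennreal_mult[symmetric])
  qed simp
  have "AE z::real^2 in lborel. z$1 \<noteq> 0" "AE z::real^2 in lborel. z$2 \<noteq> 0"
    using AE_lborel_inner_neq[of "axis 1 1 :: real^2" 0] AE_lborel_inner_neq[of "axis 2 1 :: real^2" 0]
    by (auto simp: inner_axis)
  then have "AE z in lborel.
      ennreal (norm (indicat_real (cball 0 r) z *\<^sub>R K z)) \<le> (\<Prod>b\<in>Basis. f (z \<bullet> b))"
    by eventually_elim (rule le)
  then have "(\<integral>\<^sup>+z. ennreal (norm (indicat_real (cball 0 r) z *\<^sub>R K z)) \<partial>lborel)
      \<le> (\<integral>\<^sup>+z. (\<Prod>b\<in>Basis. f ((z::real^2) \<bullet> b)) \<partial>lborel)"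
    by (rule nn_integral_mono_AE)
  also have "\<dots> = (\<Prod>b\<in>(Basis::(real^2) set). \<integral>\<^sup>+t. f t \<partial>lborel)"
    by (rule nn_integral_lborel_prod) (auto simp: f_def)
  also have "\<dots> < \<infinity>"
    using nn_integral_inv_sqrt_finite[OF True]
    by (simp add: f_def power_less_top_ennreal)
  finally show ?thesis
    unfolding set_integrable_def
    by (intro integrableI_bounded)
      (auto intro!: borel_measurable_scaleR borel_measurable_indicator K_measurable)
qed (simp add: set_integrable_def)

lemma lborel_distr_reflect: "distr lborel borel (\<lambda>y. x - y) = (lborel :: 'a::euclidean_space measure)"
  by (subst (2) lborel_affine[of "-1" x]) (auto simp: density_1)

lemma integrable_lborel_reflect:
  fixes f :: "'a::euclidean_space \<Rightarrow> 'b::euclidean_space"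
  assumes "integrable lborel f"
  shows "integrable lborel (\<lambda>y. f (x - y))"
  using integrable_distr[of "\<lambda>y. x - y" lborel borel f] assms by (simp add: lborel_distr_reflect)

lemma lborel_integral_reflect:
  fixes f :: "'a::euclidean_space \<Rightarrow> 'b::euclidean_space"
  assumes [measurable]: "f \<in> borel_measurable borel"
  shows "(LINT y|lborel. f (x - y)) = (LINT y|lborel. f y)"
  using integral_distr[of "\<lambda>y. x - y" lborel borel f] by (simp add: lborel_distr_reflect)

section \<open>Convolution with the kernel\<close>

definition K_mass :: "real \<Rightarrow> real" where
  "K_mass r = (LINT z:cball 0 r|lborel. norm (K z))"

lemma set_integrable_norm_K: "set_integrable lborel (cball 0 r) (\<lambda>z. norm (K z))"
  using set_integrable_norm[OF set_integrable_K_cball] .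

lemma K_conv_integrand_le:
  assumes "\<And>y. \<bar>w y\<bar> \<le> M"
  shows "norm (w y *\<^sub>R K (x - y))
    \<le> M * (indicator (cball 0 1) (x - y) *\<^sub>R norm (K (x - y))) + \<bar>w y\<bar> / (2*pi)"
proof (cases "x - y \<in> cball 0 1")
  case True
  then show ?thesis using assms by (simp add: mult_right_mono add_increasing2)
next
  case False
  then have "1 \<le> norm (x - y)" by simp
  then have "norm (K (x - y)) \<le> 1 / (2*pi)"
    unfolding norm_K using zero_less_norm_iff[of "x - y"] by (intro divide_left_mono mult_pos_pos) auto
  then have "\<bar>w y\<bar> * norm (K (x - y)) \<le> \<bar>w y\<bar> * (1 / (2*pi))"
    by (intro mult_left_mono) auto
  with False show ?thesis by simp
qed

text \<open>The singularity of \<open>K\<close> is integrable near the origin, where \<open>w\<close> is bounded, and \<open>K\<close> is bounded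
  away from the origin, where \<open>w\<close> is integrable.\<close>

lemma
  assumes w: "integrable lborel w" and M: "\<And>y. \<bar>w y\<bar> \<le> M"
  shows K_conv_integrable: "integrable lborel (\<lambda>y. w y *\<^sub>R K (x - y))"
    and norm_K_conv_le: "norm (K_conv w x) \<le> M * K_mass 1 + (LINT y|lborel. \<bar>w y\<bar>) / (2*pi)"
proof -
  note [measurable] = borel_measurable_integrable[OF w]
  define G where "G y = M * (indicator (cball 0 1) (x - y) *\<^sub>R norm (K (x - y))) + \<bar>w y\<bar> / (2*pi)" for y
  have near: "integrable lborel (\<lambda>y. indicator (cball 0 1) (x - y) *\<^sub>R norm (K (x - y)))"
    using integrable_lborel_reflect[OF set_integrable_norm_K[of 1, unfolded set_integrable_def]] .
  have G: "integrable lborel G"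
    unfolding G_def using w near by auto
  show *: "integrable lborel (\<lambda>y. w y *\<^sub>R K (x - y))"
    by (rule Bochner_Integration.integrable_bound[OF G])
      (use K_conv_integrand_le[OF M] in \<open>auto simp: G_def intro!: AE_I2 order_trans[OF _ abs_ge_self]\<close>)
  have "norm (K_conv w x) \<le> (LINT y|lborel. norm (w y *\<^sub>R K (x - y)))"
    unfolding K_conv_def by (rule integral_norm_bound)
  also have "\<dots> \<le> (LINT y|lborel. G y)"
    using K_conv_integrand_le[OF M] by (intro integral_mono G integrable_norm *) (simp add: G_def)
  also have "\<dots> = M * (LINT y|lborel. indicator (cball 0 1) (x - y) *\<^sub>R norm (K (x - y)))
      + (LINT y|lborel. \<bar>w y\<bar>) / (2*pi)"
    unfolding G_def using near w by simp
  also have "(LINT y|lborel. indicator (cball 0 1) (x - y) *\<^sub>R norm (K (x - y))) = K_mass 1"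
    unfolding K_mass_def set_lebesgue_integral_def
    using borel_measurable_integrable[OF set_integrable_norm_K[of 1, unfolded set_integrable_def]]
    by (intro lborel_integral_reflect) simp
  finally show "norm (K_conv w x) \<le> M * K_mass 1 + (LINT y|lborel. \<bar>w y\<bar>) / (2*pi)" .
qed

text \<open>Vorticity at distance at least 1 from both points sees a smooth kernel, so its mass alone
  controls the difference.\<close>

lemma K_conv_diff_far:
  assumes w: "integrable lborel w" and M: "\<And>y. \<bar>w y\<bar> \<le> M"
    and far: "\<And>y. norm y < R + 1 \<Longrightarrow> w y = 0"
    and x: "norm x \<le> R" "norm x' \<le> R"
  shows "norm (K_conv w x - K_conv w x') \<le> (LINT y|lborel. \<bar>w y\<bar>) / (2*pi) * norm (x - x')"
proof -
  have int: "integrable lborel (\<lambda>y. w y *\<^sub>R (K (x - y) - K (x' - y)))"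
    using Bochner_Integration.integrable_diff[OF K_conv_integrable[OF w M, of x] K_conv_integrable[OF w M, of x']]
    by (simp add: scaleR_diff_right)
  have bound: "norm (w y *\<^sub>R (K (x - y) - K (x' - y))) \<le> \<bar>w y\<bar> * (norm (x - x') / (2*pi))" for y
  proof (cases "norm y < R + 1")
    case False
    then have n: "1 \<le> norm (x - y)" "1 \<le> norm (x' - y)"
      using x norm_triangle_ineq2[of y x] norm_triangle_ineq2[of y x'] by (auto simp: norm_minus_commute)
    then have "norm (K (x - y) - K (x' - y)) = norm (x - x') / (2*pi*norm (x - y)*norm (x' - y))"
      by (subst norm_K_diff) auto
    also have "\<dots> \<le> norm (x - x') / (2*pi)"
      using n mult_mono[of 1 "norm (x - y)" 1 "norm (x' - y)"]
      by (intro divide_left_mono) (auto simp: mult.assoc)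
    finally have "\<bar>w y\<bar> * norm (K (x - y) - K (x' - y)) \<le> \<bar>w y\<bar> * (norm (x - x') / (2*pi))"
      by (rule mult_left_mono) simp
    then show ?thesis by simp
  qed (simp add: far)
  have "K_conv w x - K_conv w x' = (LINT y|lborel. w y *\<^sub>R (K (x - y) - K (x' - y)))"
    unfolding K_conv_def using K_conv_integrable[OF w M]
    by (simp add: scaleR_diff_right)
  also have "norm \<dots> \<le> (LINT y|lborel. norm (w y *\<^sub>R (K (x - y) - K (x' - y))))"
    by (rule integral_norm_bound)
  also have "\<dots> \<le> (LINT y|lborel. \<bar>w y\<bar> * (norm (x - x') / (2*pi)))"
    using w by (intro integral_mono integrable_norm int bound) auto
  also have "\<dots> = (LINT y|lborel. \<bar>w y\<bar>) / (2*pi) * norm (x - x')"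
    by simp
  finally show ?thesis .
qed

text \<open>Near the points \<open>K\<close> is not Lipschitz. Moving the translation onto the density puts the
  difference on \<open>f\<close> and needs only the integrability of \<open>K\<close> on a ball.\<close>

lemma K_conv_diff_near:
  assumes f: "integrable lborel f" and M: "\<And>y. \<bar>f y\<bar> \<le> M"
    and lip: "\<And>y y'. \<bar>f y - f y'\<bar> \<le> L * norm (y - y')"
    and near: "\<And>y. norm y > \<rho> \<Longrightarrow> f y = 0"
    and x: "norm x \<le> R" "norm x' \<le> R"
  shows "norm (K_conv f x - K_conv f x') \<le> L * K_mass (R + \<rho>) * norm (x - x')"
proof -
  note [measurable] = borel_measurable_integrable[OF f]
  have swap: "K_conv f z = (LINT y|lborel. f (z - y) *\<^sub>R K y)"
    and int: "integrable lborel (\<lambda>y. f (z - y) *\<^sub>R K y)" for z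
    using lborel_integral_reflect[of "\<lambda>y. f y *\<^sub>R K (z - y)" z]
      integrable_lborel_reflect[OF K_conv_integrable[OF f M, of z], of z]
    by (simp_all add: K_conv_def)
  have bound: "norm ((f (x - y) - f (x' - y)) *\<^sub>R K y)
      \<le> L * norm (x - x') * (indicator (cball 0 (R + \<rho>)) y *\<^sub>R norm (K y))" for y
  proof (cases "y \<in> cball 0 (R + \<rho>)")
    case True
    have "norm (x - y - (x' - y)) = norm (x - x')" by simp
    then show ?thesis using True lip[of "x - y" "x' - y"] by (simp add: mult_right_mono)
  next
    case False
    then have "norm (x - y) > \<rho>" "norm (x' - y) > \<rho>"
      using x norm_triangle_ineq2[of y x] norm_triangle_ineq2[of y x'] by (auto simp: norm_minus_commute)
    then show ?thesis using False by (simp add: near)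
  qed
  have int': "integrable lborel (\<lambda>y. (f (x - y) - f (x' - y)) *\<^sub>R K y)"
    using Bochner_Integration.integrable_diff[OF int[of x] int[of x']] by (simp add: scaleR_diff_left)
  have "K_conv f x - K_conv f x' = (LINT y|lborel. (f (x - y) - f (x' - y)) *\<^sub>R K y)"
    unfolding swap using int by (simp add: scaleR_diff_left)
  also have "norm \<dots> \<le> (LINT y|lborel. norm ((f (x - y) - f (x' - y)) *\<^sub>R K y))"
    by (rule integral_norm_bound)
  also have "\<dots> \<le> (LINT y|lborel. L * norm (x - x') * (indicator (cball 0 (R + \<rho>)) y *\<^sub>R norm (K y)))"
    using set_integrable_norm_K[of "R + \<rho>", unfolded set_integrable_def]
    by (intro integral_mono integrable_norm int' bound) auto
  also have "\<dots> = L * K_mass (R + \<rho>) * norm (x - x')"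
    by (simp add: K_mass_def set_lebesgue_integral_def)
  finally show ?thesis .
qed

text \<open>The density is split by a Lipschitz cutoff into a near part, for which its own Lipschitz
  bound on a larger ball is available, and a far part, for which only mass is known.\<close>

lemma K_conv_locally_Lipschitz:
  assumes w: "integrable lborel w" and M: "\<And>y. \<bar>w y\<bar> \<le> M" and mass: "(LINT y|lborel. \<bar>w y\<bar>) \<le> M"
    and lip: "\<And>y y'. \<lbrakk>norm y \<le> R + 2; norm y' \<le> R + 2\<rbrakk> \<Longrightarrow> \<bar>w y - w y'\<bar> \<le> L * norm (y - y')"
    and L: "0 \<le> L" and x: "norm x \<le> R" "norm x' \<le> R"
  shows "norm (K_conv w x - K_conv w x')
    \<le> ((L + M) * K_mass (2*R + 2) + M / (2*pi)) * norm (x - x')"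
proof -
  note [measurable] = borel_measurable_integrable[OF w]
  have M0: "0 \<le> M" using M[of 0] by linarith
  \<comment> \<open>The cutoff is 1 on the ball of radius \<open>R + 1\<close>, so the far part stays at distance 1 from \<open>x\<close>
    and \<open>x'\<close>, and it vanishes outside the ball of radius \<open>R + 2\<close>, where \<open>w\<close> is Lipschitz.\<close>
  define c where "c y = max 0 (min 1 (R + 2 - norm y))" for y :: "real^2"
  have c: "0 \<le> c y" "c y \<le> 1" "\<bar>c y - c y'\<bar> \<le> norm (y - y')" for y y'
    using norm_triangle_ineq3[of y y'] by (auto simp: c_def)
  have [measurable]: "c \<in> borel_measurable borel" unfolding c_def by measurable
  have cw: "\<bar>c y * w y\<bar> \<le> \<bar>w y\<bar>" "\<bar>(1 - c y) * w y\<bar> \<le> \<bar>w y\<bar>" for y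
    using c[of y] by (auto simp: abs_mult mult_left_le_one_le)
  have int: "integrable lborel (\<lambda>y. c y * w y)" "integrable lborel (\<lambda>y. (1 - c y) * w y)"
    by (rule Bochner_Integration.integrable_bound[OF w]; use cw in auto)+
  have lip1: "\<bar>c y * w y - c y' * w y'\<bar> \<le> (L + M) * norm (y - y')" if "norm y \<le> R + 2" for y y'
  proof -
    have "\<bar>c y' * (w y - w y')\<bar> \<le> L * norm (y - y')"
    proof (cases "norm y' \<le> R + 2")
      case True
      then have "\<bar>w y - w y'\<bar> \<le> L * norm (y - y')" using lip that by blast
      then show ?thesis using c[of y'] by (simp add: abs_mult) (meson abs_ge_zero mult_left_le_one_le order_trans)
    qed (use L in \<open>simp add: c_def\<close>)
    moreover have "\<bar>(c y - c y') * w y\<bar> \<le> norm (y - y') * M"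
      unfolding abs_mult using c M M0 by (intro mult_mono) auto
    moreover have "c y * w y - c y' * w y' = (c y - c y') * w y + c y' * (w y - w y')"
      by (simp add: algebra_simps)
    ultimately show ?thesis
      by (simp add: algebra_simps)
  qed
  have lip2: "\<bar>c y * w y - c y' * w y'\<bar> \<le> (L + M) * norm (y - y')" for y y'
  proof -
    consider "norm y \<le> R + 2" | "norm y' \<le> R + 2" | "norm y > R + 2" "norm y' > R + 2" by linarith
    then show ?thesis
    proof cases
      case 2
      show ?thesis using lip1[OF 2, of y] by (simp add: abs_minus_commute norm_minus_commute)
    qed (use lip1 L M0 in \<open>auto simp: c_def\<close>)
  qed
  have split: "K_conv w z = K_conv (\<lambda>y. c y * w y) z + K_conv (\<lambda>y. (1 - c y) * w y) z" for z
  proof -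
    have "K_conv (\<lambda>y. c y * w y) z + K_conv (\<lambda>y. (1 - c y) * w y) z
      = (LINT y|lborel. (c y * w y) *\<^sub>R K (z - y) + ((1 - c y) * w y) *\<^sub>R K (z - y))"
      unfolding K_conv_def
      by (intro Bochner_Integration.integral_add[symmetric]
          K_conv_integrable[OF int(1) order_trans[OF cw(1) M]] K_conv_integrable[OF int(2) order_trans[OF cw(2) M]])
    moreover have "(c y * w y) *\<^sub>R K (z - y) + ((1 - c y) * w y) *\<^sub>R K (z - y) = w y *\<^sub>R K (z - y)" for y
      by (simp add: left_diff_distrib flip: scaleR_add_left)
    ultimately show ?thesis
      by (simp add: K_conv_def)
  qed
  have "norm (K_conv (\<lambda>y. c y * w y) x - K_conv (\<lambda>y. c y * w y) x')
      \<le> (L + M) * K_mass (R + (R + 2)) * norm (x - x')"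
    by (rule K_conv_diff_near[OF int(1) order_trans[OF cw(1) M] lip2 _ x]) (auto simp: c_def)
  moreover have "norm (K_conv (\<lambda>y. (1 - c y) * w y) x - K_conv (\<lambda>y. (1 - c y) * w y) x')
      \<le> (LINT y|lborel. \<bar>(1 - c y) * w y\<bar>) / (2*pi) * norm (x - x')"
    by (rule K_conv_diff_far[OF int(2) order_trans[OF cw(2) M] _ x]) (auto simp: c_def)
  moreover have "(LINT y|lborel. \<bar>(1 - c y) * w y\<bar>) / (2*pi) * norm (x - x') \<le> M / (2*pi) * norm (x - x')"
  proof -
    have "(LINT y|lborel. \<bar>(1 - c y) * w y\<bar>) \<le> (LINT y|lborel. \<bar>w y\<bar>)"
      using int(2) w cw(2) by (intro integral_mono) auto
    then show ?thesis using mass by (intro mult_right_mono divide_right_mono) auto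
  qed
  moreover have "K_conv w x - K_conv w x' =
      (K_conv (\<lambda>y. c y * w y) x - K_conv (\<lambda>y. c y * w y) x')
    + (K_conv (\<lambda>y. (1 - c y) * w y) x - K_conv (\<lambda>y. (1 - c y) * w y) x')"
    by (simp add: split)
  moreover have "R + (R + 2) = 2*R + 2" by simp
  ultimately show ?thesis
    by (smt (verit, best) distrib_right norm_triangle_ineq)
qed

section \<open>Trajectories of a velocity field\<close>

text \<open>Both bounds express that \<open>f\<close> times an exponential is monotone. The second one plays the role of
  running the differential equation backwards from time \<open>s\<close>.\<close>

lemma Gronwall_two_sided:
  fixes f f' :: "real \<Rightarrow> real"
  assumes deriv: "\<And>s. s \<in> {0..S} \<Longrightarrow> (f has_real_derivative f' s) (at s within {0..S})"
    and bound: "\<And>s. s \<in> {0..S} \<Longrightarrow> \<bar>f' s\<bar> \<le> c * f s"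
    and s: "s \<in> {0..S}"
  shows "f s \<le> exp (c * s) * f 0" and "f 0 \<le> exp (c * s) * f s"
proof -
  have cont: "continuous_on {0..s} f"
    using s DERIV_continuous_on[of "{0..S}" f f'] deriv by (auto intro: continuous_on_subset)
  have D: "(f has_real_derivative f' r) (at r)" if "0 < r" "r < s" for r
    using deriv[of r] that s by (simp add: at_within_Icc_at)
  \<comment> \<open>The cases \<open>(\<sigma>, k) = (-1, -c)\<close> and \<open>(1, c)\<close> give the two claims.\<close>
  have mono: "\<sigma> * f 0 \<le> \<sigma> * (f s * exp (k * s))"
    if k: "\<And>r. r \<in> {0..S} \<Longrightarrow> 0 \<le> \<sigma> * (f' r + k * f r)" for \<sigma> k
  proof -
    have "\<exists>y. ((\<lambda>r. \<sigma> * (f r * exp (k * r))) has_real_derivative y) (at r) \<and> 0 \<le> y"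
      if r: "0 < r" "r < s" for r
    proof (intro exI conjI)
      have "((\<lambda>r. exp (k * r)) has_real_derivative exp (k * r) * k) (at r)"
        by (auto intro!: derivative_eq_intros)
      from DERIV_cmult[OF DERIV_mult[OF D[OF r] this], of \<sigma>]
      show "((\<lambda>r. \<sigma> * (f r * exp (k * r))) has_real_derivative \<sigma> * (f' r + k * f r) * exp (k * r)) (at r)"
        by (rule DERIV_cong) (simp add: algebra_simps)
      show "0 \<le> \<sigma> * (f' r + k * f r) * exp (k * r)"
        using k[of r] r s by (intro mult_nonneg_nonneg[of "_ * _"]) auto
    qed
    moreover have "continuous_on {0..s} (\<lambda>r. \<sigma> * (f r * exp (k * r)))"
      by (intro continuous_intros cont)
    ultimately have "\<sigma> * (f 0 * exp (k * 0)) \<le> \<sigma> * (f s * exp (k * s))"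
      using s DERIV_nonneg_imp_increasing_open[of 0 s "\<lambda>r. \<sigma> * (f r * exp (k * r))"] by simp
    then show ?thesis by simp
  qed
  have b: "f' r \<le> c * f r" "- f' r \<le> c * f r" if "r \<in> {0..S}" for r
    using bound[OF that] by linarith+
  have "-1 * f 0 \<le> -1 * (f s * exp (- c * s))"
    by (rule mono) (use b(1) in simp)
  then have "f s * exp (- c * s) \<le> f 0" by simp
  then have "f s * exp (- c * s) * exp (c * s) \<le> f 0 * exp (c * s)"
    by (rule mult_right_mono) simp
  moreover have "f s * exp (- c * s) * exp (c * s) = f s"
    unfolding mult.assoc by (subst exp_add[symmetric]) simp
  ultimately show "f s \<le> exp (c * s) * f 0"
    by (simp only: mult.commute[of "f 0"])
  have b': "0 \<le> f' r + c * f r" if "r \<in> {0..S}" for r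
    using b(2)[OF that] by linarith
  have "1 * f 0 \<le> 1 * (f s * exp (c * s))"
    by (rule mono, unfold mult_1) (rule b')
  then have "f 0 \<le> f s * exp (c * s)"
    unfolding mult_1 .
  then show "f 0 \<le> exp (c * s) * f s"
    by (subst mult.commute)
qed

lemma trajectory_displacement:
  fixes q :: "real \<Rightarrow> 'a::real_normed_vector"
  assumes "\<And>s. s \<in> {0..S} \<Longrightarrow> (q has_vector_derivative u s) (at s within {0..S})"
    and "\<And>s. s \<in> {0..S} \<Longrightarrow> norm (u s) \<le> V"
    and s: "s \<in> {0..S}"
  shows "norm (q s - q 0) \<le> V * S"
proof -
  have V: "0 \<le> V" using assms(2)[OF s] norm_ge_zero order_trans by blast
  have "norm (q s - q 0) \<le> V * norm (s - 0)"
  proof (rule differentiable_bound[of "{0..S}" q "\<lambda>s h. h *\<^sub>R u s"])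
    show "onorm (\<lambda>h. h *\<^sub>R u r) \<le> V" if "r \<in> {0..S}" for r
      by (rule onorm_bound) (use assms(2)[OF that] V in \<open>auto simp: mult.commute[of V] mult_left_mono\<close>)
  qed (use assms in \<open>auto simp: has_vector_derivative_def\<close>)
  also have "\<dots> \<le> V * S" using s V by (auto intro: mult_left_mono)
  finally show ?thesis .
qed

text \<open>Gronwall's inequality is applied to the squared distance, which is differentiable even when
  the trajectories meet. The second bound therefore says that distinct trajectories never meet.\<close>

lemma trajectories_bilipschitz:
  fixes p q :: "real \<Rightarrow> 'a::real_inner"
  assumes p: "\<And>s. s \<in> {0..S} \<Longrightarrow> (p has_vector_derivative v s (p s)) (at s within {0..S})"
    and q: "\<And>s. s \<in> {0..S} \<Longrightarrow> (q has_vector_derivative v s (q s)) (at s within {0..S})"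
    and lip: "\<And>s. s \<in> {0..S} \<Longrightarrow> norm (v s (p s) - v s (q s)) \<le> L * norm (p s - q s)"
    and s: "s \<in> {0..S}"
  shows "norm (p s - q s) \<le> exp (L * s) * norm (p 0 - q 0)"
    and "norm (p 0 - q 0) \<le> exp (L * s) * norm (p s - q s)"
proof -
  define f where "f r = (p r - q r) \<bullet> (p r - q r)" for r
  define f' where "f' r = 2 * ((p r - q r) \<bullet> (v r (p r) - v r (q r)))" for r
  have f: "f r = (norm (p r - q r))\<^sup>2" for r by (simp add: f_def power2_norm_eq_inner)
  have D: "(f has_real_derivative f' r) (at r within {0..S})" if "r \<in> {0..S}" for r
  proof -
    have "((\<lambda>r. p r - q r) has_vector_derivative v r (p r) - v r (q r)) (at r within {0..S})"
      using p[OF that] q[OF that] by (rule has_vector_derivative_diff)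
    from has_derivative_inner[OF this[unfolded has_vector_derivative_def] this[unfolded has_vector_derivative_def]]
    show ?thesis
      unfolding f_def[abs_def] f'_def has_field_derivative_def
      by (rule has_derivative_eq_rhs) (auto simp: inner_commute algebra_simps)
  qed
  have b: "\<bar>f' r\<bar> \<le> (2*L) * f r" if "r \<in> {0..S}" for r
  proof -
    have "\<bar>f' r\<bar> \<le> 2 * (norm (p r - q r) * norm (v r (p r) - v r (q r)))"
      unfolding f'_def by (simp add: abs_mult Cauchy_Schwarz_ineq2)
    also have "\<dots> \<le> 2 * (norm (p r - q r) * (L * norm (p r - q r)))"
      using lip[OF that] by (intro mult_left_mono) auto
    finally show ?thesis by (simp add: f power2_eq_square algebra_simps)
  qed
  have e: "exp (2*L * s) = (exp (L * s))\<^sup>2" by (simp add: power2_eq_square flip: exp_add)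
  show "norm (p s - q s) \<le> exp (L * s) * norm (p 0 - q 0)"
  proof (rule power2_le_imp_le)
    show "(norm (p s - q s))\<^sup>2 \<le> (exp (L * s) * norm (p 0 - q 0))\<^sup>2"
      using Gronwall_two_sided(1)[OF D b s] unfolding f e power_mult_distrib .
  qed simp
  show "norm (p 0 - q 0) \<le> exp (L * s) * norm (p s - q s)"
  proof (rule power2_le_imp_le)
    show "(norm (p 0 - q 0))\<^sup>2 \<le> (exp (L * s) * norm (p s - q s))\<^sup>2"
      using Gronwall_two_sided(2)[OF D b s] unfolding f e power_mult_distrib .
  qed simp
qed

text \<open>A preimage of \<open>y\<close> is a fixed point of \<open>a \<mapsto> y - (q a - a)\<close>, which maps a ball around \<open>y\<close> into
  itself.\<close>

lemma surj_bounded_displacement: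
  fixes q :: "'a::euclidean_space \<Rightarrow> 'a"
  assumes cont: "continuous_on UNIV q" and bound: "\<And>a. norm (q a - a) \<le> C"
  shows "surj q"
proof -
  have "\<exists>a. q a = y" for y
  proof -
    have "\<bar>C\<bar> + 1 > 0" by simp
    moreover have "continuous_on (cball y (\<bar>C\<bar> + 1)) (\<lambda>a. y - (q a - a))"
      by (intro continuous_intros continuous_on_subset[OF cont]) auto
    moreover have "(\<lambda>a. y - (q a - a)) \<in> cball y (\<bar>C\<bar> + 1) \<rightarrow> cball y (\<bar>C\<bar> + 1)"
    proof
      show "y - (q a - a) \<in> cball y (\<bar>C\<bar> + 1)" for a
        using bound[of a] by (simp add: dist_norm)
    qed
    ultimately obtain a where "y - (q a - a) = a" by (rule brouwer_ball)
    then have "q a = y" by (simp add: algebra_simps)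
    then show ?thesis ..
  qed
  then show ?thesis by (metis surjI)
qed

section \<open>Partial derivatives and the Poisson bracket\<close>

lemma partial_has_derivative:
  assumes "(f has_derivative f') (at x)"
  shows "partial i f x = f' (axis i 1)"
proof -
  have "((\<lambda>t. x + t *\<^sub>R axis i (1::real)) has_derivative (\<lambda>t. t *\<^sub>R axis i 1)) (at 0)"
    by (auto intro!: derivative_eq_intros)
  moreover have "(f has_derivative f') (at (x + 0 *\<^sub>R axis i 1))" using assms by simp
  ultimately have "((\<lambda>t. f (x + t *\<^sub>R axis i 1)) has_derivative (\<lambda>t. f' (t *\<^sub>R axis i 1))) (at 0)"
    by (rule has_derivative_compose)
  then have "((\<lambda>t. f (x + t *\<^sub>R axis i 1)) has_real_derivative f' (axis i 1)) (at 0)"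
    unfolding has_field_derivative_def using linear_scale[OF has_derivative_linear[OF assms]]
    by (simp add: mult_commute_abs)
  then show ?thesis unfolding partial_def by (rule DERIV_imp_deriv)
qed

lemma linear_vec2:
  assumes "linear (f :: real^2 \<Rightarrow> real)"
  shows "f h = h$1 * f (axis 1 1) + h$2 * f (axis 2 1)"
proof -
  have "h = h$1 *\<^sub>R axis 1 1 + h$2 *\<^sub>R axis 2 1"
    by (simp add: vec_eq_iff forall_2 axis_def)
  then have "f h = f (h$1 *\<^sub>R axis 1 1 + h$2 *\<^sub>R axis 2 1)" by (rule arg_cong)
  also have "\<dots> = h$1 * f (axis 1 1) + h$2 * f (axis 2 1)"
    by (simp only: linear_add[OF assms] linear_scale[OF assms] real_scaleR_def)
  finally show ?thesis .
qed

text \<open>The chain rule gives \<open>\<nabla>\<theta>0 = DQ\<^sup>T \<nabla>\<theta>\<close>; inserted into the bracket, the terms with \<open>\<partial>\<^sub>1\<theta>\<close> cancel and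
  those with \<open>\<partial>\<^sub>2\<theta>\<close> collect the factor \<open>det DQ = 1\<close>.\<close>

lemma partial_2_eq_bracket:
  fixes q :: "real^2 \<Rightarrow> real^2" and \<theta> :: "real^2 \<Rightarrow> real"
  assumes q: "area_preserving q" and \<theta>: "(\<theta> has_derivative \<theta>') (at (q a))"
    and transport: "\<And>b. \<theta>0 b = \<theta> (q b)"
  shows "partial 2 \<theta> (q a) = poisson_bracket (\<lambda>b. q b $ 1) \<theta>0 a"
proof -
  define q' where "q' = frechet_derivative q (at a)"
  have q': "(q has_derivative q') (at a)" and det: "det (matrix q') = 1"
    using q by (auto simp: area_preserving_def q'_def jacobian_def frechet_derivative_works)
  have q1: "((\<lambda>b. q b $ 1) has_derivative (\<lambda>h. q' h $ 1)) (at a)"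
    using bounded_linear.has_derivative[OF bounded_linear_vec_nth q'] .
  have \<theta>0: "(\<theta>0 has_derivative (\<lambda>h. \<theta>' (q' h))) (at a)"
    using has_derivative_compose[OF q' \<theta>] unfolding transport[symmetric] .
  have det2: "q' (axis 1 1) $ 1 * q' (axis 2 1) $ 2 - q' (axis 2 1) $ 1 * q' (axis 1 1) $ 2 = 1"
    using det by (simp add: det_2 matrix_def)
  have "poisson_bracket (\<lambda>b. q b $ 1) \<theta>0 a
    = (q' (axis 1 1) $ 1 * q' (axis 2 1) $ 2 - q' (axis 2 1) $ 1 * q' (axis 1 1) $ 2) * \<theta>' (axis 2 1)"
    unfolding poisson_bracket_def partial_has_derivative[OF q1] partial_has_derivative[OF \<theta>0]
    unfolding linear_vec2[OF has_derivative_linear[OF \<theta>], of "q' (axis 1 1)"]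
      linear_vec2[OF has_derivative_linear[OF \<theta>], of "q' (axis 2 1)"]
    by (simp add: algebra_simps)
  then show ?thesis
    by (simp add: det2 partial_has_derivative[OF \<theta>])
qed

section \<open>Smooth functions on the space-time slab\<close>

lemma smooth_slabE:
  assumes "smooth_on ({0..S} \<times> UNIV) (\<lambda>(s, x). f s x)"
  obtains D where
    "\<And>s x. s \<in> {0..S} \<Longrightarrow>
      ((\<lambda>(s, x). f s x) has_derivative D (s, x)) (at (s, x) within {0..S} \<times> UNIV)"
    "\<And>h. continuous_on ({0..S} \<times> UNIV) (\<lambda>z. D z h)"
proof -
  have "Ck_on (Suc 0) ({0..S} \<times> UNIV) (\<lambda>(s, x). f s x)"
    using assms unfolding smooth_on_def by blast
  then obtain D where D: "\<forall>z\<in>{0..S} \<times> UNIV. ((\<lambda>(s, x). f s x) has_derivative D z) (at z within {0..S} \<times> UNIV)"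
      "\<forall>h. continuous_on ({0..S} \<times> UNIV) (\<lambda>z. D z h)"
    by auto
  show thesis by (rule that[of D]) (use D in auto)
qed

lemma slab_derivative_space:
  assumes "((\<lambda>(s, x). f s x) has_derivative D) (at (s, x) within {0..S} \<times> UNIV)" and s: "s \<in> {0..S}"
  shows "(f s has_derivative (\<lambda>h. D (0, h))) (at x)"
proof -
  have "((\<lambda>y. (s, y)) has_derivative (\<lambda>h. (0, h))) (at x within UNIV)"
    by (auto intro!: derivative_eq_intros)
  moreover have "((\<lambda>(s, x). f s x) has_derivative D) (at (s, x) within (\<lambda>y. (s, y)) ` UNIV)"
    by (rule has_derivative_subset[OF assms(1)]) (use s in auto)
  ultimately show ?thesis using has_derivative_in_compose by fastforce
qed

lemma slab_derivative_along:
  assumes D: "((\<lambda>(s, x). f s x) has_derivative D) (at (s, q s) within {0..S} \<times> UNIV)"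
    and q: "(q has_vector_derivative u) (at s within {0..S})"
  shows "((\<lambda>r. f r (q r)) has_vector_derivative D (1, u)) (at s within {0..S})"
proof -
  have "((\<lambda>r. (r, q r)) has_derivative (\<lambda>h. (h, h *\<^sub>R u))) (at s within {0..S})"
    using q unfolding has_vector_derivative_def by (auto intro!: derivative_eq_intros)
  moreover have "((\<lambda>(s, x). f s x) has_derivative D) (at (s, q s) within (\<lambda>r. (r, q r)) ` {0..S})"
    by (rule has_derivative_subset[OF D]) auto
  ultimately have "((\<lambda>r. f r (q r)) has_derivative (\<lambda>h. D (h, h *\<^sub>R u))) (at s within {0..S})"
    using has_derivative_in_compose by fastforce
  moreover have "D (h, h *\<^sub>R u) = h *\<^sub>R D (1, u)" for h
    using linear_scale[OF has_derivative_linear[OF D], of h "(1, u)"] by simp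
  ultimately show ?thesis
    unfolding has_vector_derivative_def by simp
qed

text \<open>The time derivative is taken within \<open>{0..S}\<close>; it determines the value of \<open>vector_derivative\<close>
  only because \<open>0 < S\<close> makes the interval non-degenerate.\<close>

lemma material_derivative:
  fixes f :: "real \<Rightarrow> real^2 \<Rightarrow> real"
  assumes smooth: "smooth_on ({0..S} \<times> UNIV) (\<lambda>(s, x). f s x)" and S: "0 < S" and s: "s \<in> {0..S}"
    and q: "(q has_vector_derivative u) (at s within {0..S})"
  shows "((\<lambda>r. f r (q r)) has_vector_derivative
      (vector_derivative (\<lambda>r. f r (q s)) (at s within {0..S}) + u \<bullet> grad (f s) (q s))) (at s within {0..S})"
proof -
  obtain D' where D': "\<And>s x. s \<in> {0..S} \<Longrightarrow>
        ((\<lambda>(s, x). f s x) has_derivative D' (s, x)) (at (s, x) within {0..S} \<times> UNIV)"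
    by (rule smooth_slabE[OF smooth]) blast
  define D where "D x = D' (s, x)" for x
  have D: "((\<lambda>(s, x). f s x) has_derivative D x) (at (s, x) within {0..S} \<times> UNIV)" for x
    unfolding D_def by (rule D'[OF s])
  have lin: "linear (D x)" for x using D by (rule has_derivative_linear)
  have dx: "(f s has_derivative (\<lambda>h. D (q s) (0, h))) (at (q s))"
    by (rule slab_derivative_space[OF D s])
  have "((\<lambda>r. f r (q s)) has_vector_derivative D (q s) (1, 0)) (at s within {0..S})"
    by (rule slab_derivative_along[of _ _ _ "\<lambda>_. q s", OF D]) (rule has_vector_derivative_const)
  then have ds: "vector_derivative (\<lambda>r. f r (q s)) (at s within {0..S}) = D (q s) (1, 0)"
    using vector_derivative_within_cbox[of 0 S s] S s by auto
  have "u \<bullet> grad (f s) (q s) = D (q s) (0, u)"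
    using linear_vec2[OF has_derivative_linear[OF dx], of u]
    by (simp add: grad_def inner_vec_def sum_2 partial_has_derivative[OF dx])
  moreover have "D (q s) (1, u) = D (q s) (1, 0) + D (q s) (0, u)"
    using linear_add[OF lin, of "q s" "(1, 0)" "(0, u)"] by simp
  ultimately show ?thesis
    using slab_derivative_along[OF D q] ds by simp
qed

text \<open>The spatial derivatives are continuous on the compact set \<open>{0..S} \<times> cball 0 R\<close>, which makes the
  Lipschitz constant independent of time.\<close>

lemma smooth_slab_Lipschitz:
  fixes f :: "real \<Rightarrow> real^2 \<Rightarrow> real"
  assumes smooth: "smooth_on ({0..S} \<times> UNIV) (\<lambda>(s, x). f s x)"
  obtains L where "0 \<le> L"
    "\<And>s y y'. \<lbrakk>s \<in> {0..S}; norm y \<le> R; norm y' \<le> R\<rbrakk> \<Longrightarrow> \<bar>f s y - f s y'\<bar> \<le> L * norm (y - y')"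
proof -
  obtain D where D: "\<And>s x. s \<in> {0..S} \<Longrightarrow>
        ((\<lambda>(s, x). f s x) has_derivative D (s, x)) (at (s, x) within {0..S} \<times> UNIV)"
    and cont: "\<And>h. continuous_on ({0..S} \<times> UNIV) (\<lambda>z. D z h)"
    by (rule smooth_slabE[OF smooth]) blast
  have "\<exists>C. \<forall>s\<in>{0..S}. \<forall>x\<in>cball 0 R. \<bar>D (s, x) (0, h)\<bar> \<le> C" for h
  proof -
    have "compact ((\<lambda>z. D z (0, h)) ` ({0..S} \<times> cball 0 R))"
      by (intro compact_continuous_image compact_Times continuous_on_subset[OF cont]) auto
    then have "bounded ((\<lambda>z. D z (0, h)) ` ({0..S} \<times> cball 0 R))"
      by (rule compact_imp_bounded)
    then show ?thesis by (auto simp: bounded_iff)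
  qed
  then obtain C where C: "\<And>h s x. \<lbrakk>s \<in> {0..S}; x \<in> cball 0 R\<rbrakk> \<Longrightarrow> \<bar>D (s, x) (0, h)\<bar> \<le> C h"
    by metis
  define L where "L = \<bar>C (axis 1 1)\<bar> + \<bar>C (axis 2 1)\<bar>"
  have "\<bar>f s y - f s y'\<bar> \<le> L * norm (y - y')" if s: "s \<in> {0..S}" and y: "norm y \<le> R" "norm y' \<le> R" for s y y'
  proof -
    have dx: "(f s has_derivative (\<lambda>h. D (s, x) (0, h))) (at x)" for x
      by (rule slab_derivative_space[OF D[OF s] s])
    have "norm (f s y - f s y') \<le> L * norm (y - y')"
    proof (rule differentiable_bound[of "cball 0 R" "f s" "\<lambda>x h. D (s, x) (0, h)"])
      fix x :: "real^2" assume x: "x \<in> cball 0 R"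
      show "onorm (\<lambda>h. D (s, x) (0, h)) \<le> L"
      proof (rule onorm_bound)
        fix h :: "real^2"
        have "norm (D (s, x) (0, h)) \<le> \<bar>h$1\<bar> * \<bar>D (s, x) (0, axis 1 1)\<bar> + \<bar>h$2\<bar> * \<bar>D (s, x) (0, axis 2 1)\<bar>"
          using linear_vec2[OF has_derivative_linear[OF dx], of x h]
            abs_triangle_ineq[of "h$1 * D (s, x) (0, axis 1 1)" "h$2 * D (s, x) (0, axis 2 1)"]
          by (simp add: abs_mult)
        also have "\<dots> \<le> norm h * \<bar>C (axis 1 1)\<bar> + norm h * \<bar>C (axis 2 1)\<bar>"
          using C[OF s x] by (intro add_mono mult_mono component_le_norm_cart order_trans[OF C[OF s x] abs_ge_self]) auto
        finally show "norm (D (s, x) (0, h)) \<le> L * norm h"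
          by (simp add: L_def algebra_simps)
      qed (simp add: L_def)
    qed (use y in \<open>auto intro: has_derivative_at_withinI[OF dx]\<close>)
    then show ?thesis by simp
  qed
  then show thesis using that[of L] by (simp add: L_def)
qed

section \<open>Velocity and flow of a smooth solution\<close>

lemma smooth_solutionD:
  assumes "smooth_solution S \<omega> \<theta>"
  shows "smooth_on ({0..S} \<times> UNIV) (\<lambda>(s, x). \<omega> s x)" "smooth_on ({0..S} \<times> UNIV) (\<lambda>(s, x). \<theta> s x)"
    "\<And>s x. s \<in> {0..S} \<Longrightarrow> vector_derivative (\<lambda>r. \<omega> r x) (at s within {0..S}) + velocity \<omega> s x \<bullet> grad (\<omega> s) x
          = partial 2 (\<theta> s) x"
    "\<And>s x. s \<in> {0..S} \<Longrightarrow> vector_derivative (\<lambda>r. \<theta> r x) (at s within {0..S}) + velocity \<omega> s x \<bullet> grad (\<theta> s) x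
          = 0"
  using assms unfolding smooth_solution_def by blast+

lemma smooth_solution_boundE:
  assumes "smooth_solution S \<omega> \<theta>"
  obtains M where "\<And>s x. s \<in> {0..S} \<Longrightarrow> \<bar>\<omega> s x\<bar> \<le> M"
    "\<And>s. s \<in> {0..S} \<Longrightarrow> integrable lborel (\<omega> s)"
    "\<And>s. s \<in> {0..S} \<Longrightarrow> (LINT x|lborel. \<bar>\<omega> s x\<bar>) \<le> M"
  using assms unfolding smooth_solution_def by blast

lemma velocity_bounded:
  assumes "smooth_solution S \<omega> \<theta>"
  obtains V where "\<And>s x. s \<in> {0..S} \<Longrightarrow> norm (velocity \<omega> s x) \<le> V"
proof -
  obtain M where M: "\<And>s x. s \<in> {0..S} \<Longrightarrow> \<bar>\<omega> s x\<bar> \<le> M"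
    "\<And>s. s \<in> {0..S} \<Longrightarrow> integrable lborel (\<omega> s)"
    "\<And>s. s \<in> {0..S} \<Longrightarrow> (LINT x|lborel. \<bar>\<omega> s x\<bar>) \<le> M"
    using smooth_solution_boundE[OF assms] by blast
  define V where "V = M * K_mass 1 + M / (2*pi)"
  have V: "norm (K_conv (\<omega> s) x) \<le> V" if s: "s \<in> {0..S}" for s x
  proof -
    have "norm (K_conv (\<omega> s) x) \<le> M * K_mass 1 + (LINT y|lborel. \<bar>\<omega> s y\<bar>) / (2*pi)"
      by (rule norm_K_conv_le[OF M(2)[OF s] M(1)[OF s]])
    also have "\<dots> \<le> V"
      unfolding V_def using M(3)[OF s] by (intro add_left_mono divide_right_mono) auto
    finally show ?thesis .
  qed
  have "norm (velocity \<omega> s x) \<le> V + V" if s: "s \<in> {0..S}" for s x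
    unfolding velocity_def using V[OF s] by (intro norm_triangle_le_diff add_mono)
  then show thesis by (rule that)
qed

lemma velocity_locally_Lipschitz:
  assumes "smooth_solution S \<omega> \<theta>"
  obtains L where "\<And>s x x'. \<lbrakk>s \<in> {0..S}; norm x \<le> R; norm x' \<le> R\<rbrakk> \<Longrightarrow>
    norm (velocity \<omega> s x - velocity \<omega> s x') \<le> L * norm (x - x')"
proof -
  obtain M where M: "\<And>s x. s \<in> {0..S} \<Longrightarrow> \<bar>\<omega> s x\<bar> \<le> M"
    "\<And>s. s \<in> {0..S} \<Longrightarrow> integrable lborel (\<omega> s)"
    "\<And>s. s \<in> {0..S} \<Longrightarrow> (LINT x|lborel. \<bar>\<omega> s x\<bar>) \<le> M"
    using smooth_solution_boundE[OF assms] by blast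
  obtain L where L: "0 \<le> L" "\<And>s y y'. \<lbrakk>s \<in> {0..S}; norm y \<le> R + 2; norm y' \<le> R + 2\<rbrakk> \<Longrightarrow>
      \<bar>\<omega> s y - \<omega> s y'\<bar> \<le> L * norm (y - y')"
    using smooth_slab_Lipschitz[OF smooth_solutionD(1)[OF assms], of "R + 2"] by blast
  show thesis
  proof (rule that)
    show "norm (velocity \<omega> s x - velocity \<omega> s x') \<le> ((L + M) * K_mass (2*R + 2) + M / (2*pi)) * norm (x - x')"
      if s: "s \<in> {0..S}" and x: "norm x \<le> R" "norm x' \<le> R" for s x x'
      using K_conv_locally_Lipschitz[OF M(2)[OF s] M(1)[OF s] M(3)[OF s] L(2)[OF s] L(1) x]
      by (simp add: velocity_def)
  qed
qed

lemma flow_displacement: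
  assumes "smooth_solution S \<omega> \<theta>" and Q: "material_map S (velocity \<omega>) Q"
  obtains C where "\<And>s a. s \<in> {0..S} \<Longrightarrow> norm (Q s a - a) \<le> C"
proof -
  obtain V where V: "\<And>s x. s \<in> {0..S} \<Longrightarrow> norm (velocity \<omega> s x) \<le> V"
    using velocity_bounded[OF assms(1)] by blast
  have "norm (Q s a - a) \<le> V * S" if "s \<in> {0..S}" for s and a :: "real^2"
    using trajectory_displacement[of S "\<lambda>s. Q s a" "\<lambda>s. velocity \<omega> s (Q s a)" V s] Q V that
    by (simp add: material_map_def)
  then show thesis by (rule that)
qed

text \<open>Displacements are bounded, so all trajectories that start in a ball remain in a larger one, on
  which the velocity has a single Lipschitz constant.\<close>

lemma flow_bilipschitz:
  assumes sol: "smooth_solution S \<omega> \<theta>" and Q: "material_map S (velocity \<omega>) Q"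
  obtains L where "0 \<le> L"
    "\<And>s a b. \<lbrakk>s \<in> {0..S}; norm a \<le> R; norm b \<le> R\<rbrakk> \<Longrightarrow> norm (Q s a - Q s b) \<le> L * norm (a - b)"
    "\<And>s a b. \<lbrakk>s \<in> {0..S}; norm a \<le> R; norm b \<le> R\<rbrakk> \<Longrightarrow> norm (a - b) \<le> L * norm (Q s a - Q s b)"
proof -
  obtain C where C: "\<And>s a. s \<in> {0..S} \<Longrightarrow> norm (Q s a - a) \<le> C"
    using flow_displacement[OF sol Q] by blast
  obtain L where L: "\<And>s x x'. \<lbrakk>s \<in> {0..S}; norm x \<le> R + C; norm x' \<le> R + C\<rbrakk> \<Longrightarrow>
      norm (velocity \<omega> s x - velocity \<omega> s x') \<le> L * norm (x - x')"
    using velocity_locally_Lipschitz[OF sol, of "R + C"] by blast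
  have stay: "norm (Q s a) \<le> R + C" if "s \<in> {0..S}" "norm a \<le> R" for s and a :: "real^2"
    using C[OF that(1), of a] that(2) norm_triangle_sub[of "Q s a" a] by linarith
  have Q0: "Q 0 a = a" for a :: "real^2" using Q by (simp add: material_map_def)
  have Qs: "((\<lambda>r. Q r a) has_vector_derivative velocity \<omega> s (Q s a)) (at s within {0..S})"
    if "s \<in> {0..S}" for s and a :: "real^2"
    using Q that by (simp add: material_map_def)
  have lip: "norm (velocity \<omega> s (Q s a) - velocity \<omega> s (Q s b)) \<le> \<bar>L\<bar> * norm (Q s a - Q s b)"
    if "s \<in> {0..S}" "norm a \<le> R" "norm b \<le> R" for s and a b :: "real^2"
    using L[OF that(1) stay[OF that(1,2)] stay[OF that(1,3)]]
    by (rule order_trans) (intro mult_right_mono; simp)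
  have e: "exp (\<bar>L\<bar> * s) * norm z \<le> exp (\<bar>L\<bar> * S) * norm z" if "s \<in> {0..S}" for s and z :: "real^2"
    using that by (intro mult_right_mono) (auto intro: mult_left_mono)
  show thesis
  proof (rule that[of "exp (\<bar>L\<bar> * S)"])
    fix s and a b :: "real^2" assume s: "s \<in> {0..S}" and ab: "norm a \<le> R" "norm b \<le> R"
    note * = trajectories_bilipschitz[of S "\<lambda>r. Q r a" "velocity \<omega>" "\<lambda>r. Q r b" "\<bar>L\<bar>" s, OF Qs Qs lip[OF _ ab] s]
    show "norm (Q s a - Q s b) \<le> exp (\<bar>L\<bar> * S) * norm (a - b)"
      using *(1) e[OF s, of "a - b"] by (simp add: Q0)
    show "norm (a - b) \<le> exp (\<bar>L\<bar> * S) * norm (Q s a - Q s b)"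
      using *(2) e[OF s, of "Q s a - Q s b"] by (simp add: Q0)
  qed simp
qed

section \<open>Differentiation under a time integral\<close>

text \<open>The Lipschitz bound dominates the difference quotients, so dominated convergence applies.
  It is used twice: along a fixed direction it yields the integrability of \<open>r \<mapsto> g' r h\<close> and the bound
  \<open>\<bar>g' r h\<bar> \<le> L * norm h\<close>, which together with the Lipschitz bound dominates the remainders.\<close>

lemma has_derivative_integral_Lipschitz:
  fixes g :: "real \<Rightarrow> 'a::euclidean_space \<Rightarrow> real"
  assumes int: "\<And>b. (\<lambda>r. g r b) integrable_on {0..s}"
    and deriv: "\<And>r. r \<in> {0..s} \<Longrightarrow> (g r has_derivative g' r) (at a)"
    and lip: "\<And>r b. \<lbrakk>r \<in> {0..s}; norm (b - a) \<le> 1\<rbrakk> \<Longrightarrow> \<bar>g r b - g r a\<bar> \<le> L * norm (b - a)"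
  shows "(\<lambda>r. g' r h) integrable_on {0..s}"
    and "((\<lambda>b. integral {0..s} (\<lambda>r. g r b)) has_derivative (\<lambda>h. integral {0..s} (\<lambda>r. g' r h))) (at a)"
proof -
  have lin: "linear (g' r)" if "r \<in> {0..s}" for r
    using deriv[OF that] by (rule has_derivative_linear)
  have *: "(\<lambda>r. g' r h) integrable_on {0..s} \<and> (\<forall>r\<in>{0..s}. \<bar>g' r h\<bar> \<le> L * norm h)" for h
  proof -
    \<comment> \<open>Step sizes tending to 0 and so small that \<open>a + t k *\<^sub>R h\<close> stays in the unit ball around \<open>a\<close>.\<close>
    define t where "t k = 1 / (real (Suc k) * (1 + norm h))" for k
    have t: "0 < t k" "t k * norm h \<le> 1" for k
    proof -
      have p: "0 < 1 + norm h" by (simp add: add_pos_nonneg)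
      then show "0 < t k" by (simp add: t_def)
      have "norm h \<le> 1 * (1 + norm h)" by simp
      also have "\<dots> \<le> real (Suc k) * (1 + norm h)"
        using p by (intro mult_right_mono) auto
      finally show "t k * norm h \<le> 1" using p by (simp add: t_def divide_le_eq)
    qed
    have "(\<lambda>k. 1 / (1 + norm h) * inverse (real (Suc k))) \<longlonglongrightarrow> 1 / (1 + norm h) * 0"
      by (intro tendsto_mult tendsto_const LIMSEQ_inverse_real_of_nat)
    then have t0: "t \<longlonglongrightarrow> 0"
      by (simp add: t_def[abs_def] divide_simps mult.commute)
    define q where "q k r = (g r (a + t k *\<^sub>R h) - g r a) / t k" for k r
    have q_int: "q k integrable_on {0..s}" for k
      unfolding q_def[abs_def] by (intro integrable_on_divide integrable_diff int)
    have q_le: "\<bar>q k r\<bar> \<le> L * norm h" if "r \<in> {0..s}" for k r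
      using lip[OF that, of "a + t k *\<^sub>R h"] t[of k] by (simp add: q_def divide_le_eq mult_ac)
    have q_lim: "(\<lambda>k. q k r) \<longlonglongrightarrow> g' r h" if r: "r \<in> {0..s}" for r
    proof -
      have "((\<lambda>u. a + u *\<^sub>R h) has_derivative (\<lambda>u. u *\<^sub>R h)) (at 0)"
        by (auto intro!: derivative_eq_intros)
      moreover have "(g r has_derivative g' r) (at (a + 0 *\<^sub>R h))" using deriv[OF r] by simp
      ultimately have "((\<lambda>u. g r (a + u *\<^sub>R h)) has_derivative (\<lambda>u. g' r (u *\<^sub>R h))) (at 0)"
        by (rule has_derivative_compose)
      then have "((\<lambda>u. g r (a + u *\<^sub>R h)) has_real_derivative g' r h) (at 0)"
        unfolding has_field_derivative_def by (simp add: linear_scale[OF lin[OF r]] mult_commute_abs)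
      then have "((\<lambda>u. (g r (a + u *\<^sub>R h) - g r a) / u) \<longlongrightarrow> g' r h) (at 0)"
        unfolding DERIV_def by simp
      then show ?thesis
        unfolding q_def
        by (rule filterlim_compose)
          (use t0 t(1) in \<open>auto simp: filterlim_at intro!: always_eventually less_imp_neq[symmetric]\<close>)
    qed
    have "(\<lambda>r. g' r h) integrable_on {0..s}"
      by (rule dominated_convergence(1)[of q "{0..s}" "\<lambda>_. L * norm h"])
        (use q_int q_le q_lim in auto)
    moreover have "\<bar>g' r h\<bar> \<le> L * norm h" if r: "r \<in> {0..s}" for r
      by (rule LIMSEQ_le_const2[OF tendsto_rabs[OF q_lim[OF r]]]) (use q_le[OF r] in auto)
    ultimately show ?thesis by blast
  qed
  then show g'_int: "(\<lambda>r. g' r h) integrable_on {0..s}" for h by blast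
  define G where "G h = integral {0..s} (\<lambda>r. g' r h)" for h
  have "linear G"
  proof (rule linearI)
    show "G (h + k) = G h + G k" for h k
    proof -
      have "G (h + k) = integral {0..s} (\<lambda>r. g' r h + g' r k)"
        unfolding G_def by (intro integral_cong) (simp add: linear_add[OF lin])
      then show ?thesis using integral_add[OF g'_int[of h] g'_int[of k]] by (simp add: G_def)
    qed
    show "G (c *\<^sub>R h) = c *\<^sub>R G h" for c h
    proof -
      have "G (c *\<^sub>R h) = integral {0..s} (\<lambda>r. c *\<^sub>R g' r h)"
        unfolding G_def by (intro integral_cong) (simp add: linear_scale[OF lin])
      then show ?thesis by (simp add: G_def)
    qed
  qed
  then have bl: "bounded_linear G" by (simp add: linear_conv_bounded_linear)
  have "((\<lambda>b. norm (integral {0..s} (\<lambda>r. g r b) - integral {0..s} (\<lambda>r. g r a) - G (b - a)) / norm (b - a))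
    \<longlongrightarrow> 0) (at a)"
    unfolding tendsto_at_iff_sequentially
  proof (intro allI impI)
    fix X :: "nat \<Rightarrow> 'a" assume X: "\<forall>i. X i \<in> UNIV - {a}" and lim: "X \<longlonglongrightarrow> a"
    obtain N where N: "\<And>n. n \<ge> N \<Longrightarrow> norm (X n - a) < 1"
      using LIMSEQ_D[OF lim, of 1] by auto
    define Y where "Y n = X (n + N)" for n
    have Y: "Y n \<noteq> a" "norm (Y n - a) \<le> 1" for n
      using X N[of "n + N"] by (auto simp: Y_def)
    have Y0: "Y \<longlonglongrightarrow> a" unfolding Y_def[abs_def] using lim by (rule LIMSEQ_ignore_initial_segment)
    define \<phi> where "\<phi> n r = (g r (Y n) - g r a - g' r (Y n - a)) / norm (Y n - a)" for n r
    have \<phi>_int: "\<phi> n integrable_on {0..s}" for n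
      unfolding \<phi>_def[abs_def] by (intro integrable_on_divide integrable_diff int g'_int)
    have \<phi>_le: "\<bar>\<phi> n r\<bar> \<le> 2 * L" if r: "r \<in> {0..s}" for n r
    proof -
      have "\<bar>g' r (Y n - a)\<bar> \<le> L * norm (Y n - a)" using * r by blast
      then have "\<bar>g r (Y n) - g r a - g' r (Y n - a)\<bar> \<le> 2 * L * norm (Y n - a)"
        using lip[OF r Y(2)[of n]] by linarith
      then show ?thesis using Y(1)[of n] by (simp add: \<phi>_def divide_le_eq)
    qed
    have \<phi>_lim: "(\<lambda>n. \<phi> n r) \<longlonglongrightarrow> 0" if r: "r \<in> {0..s}" for r
    proof -
      have "((\<lambda>b. (g r b - g r a - g' r (b - a)) /\<^sub>R norm (b - a)) \<longlongrightarrow> 0) (at a)"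
        using deriv[OF r] unfolding has_derivative_at_within by simp
      then have "(\<lambda>n. (g r (Y n) - g r a - g' r (Y n - a)) /\<^sub>R norm (Y n - a)) \<longlonglongrightarrow> 0"
        using Y(1) Y0 by (auto simp: tendsto_at_iff_sequentially o_def)
      then show ?thesis by (simp add: \<phi>_def divide_inverse mult.commute)
    qed
    have "(\<lambda>n. integral {0..s} (\<phi> n)) \<longlonglongrightarrow> integral {0..s} (\<lambda>_. 0)"
      by (rule dominated_convergence(2)[of \<phi> "{0..s}" "\<lambda>_. 2 * L"])
        (use \<phi>_int \<phi>_le \<phi>_lim in auto)
    moreover have "integral {0..s} (\<phi> n)
      = (integral {0..s} (\<lambda>r. g r (Y n)) - integral {0..s} (\<lambda>r. g r a) - G (Y n - a)) / norm (Y n - a)" for n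
      unfolding \<phi>_def G_def by (simp add: integral_diff integrable_diff int g'_int)
    ultimately have "(\<lambda>n. \<bar>(integral {0..s} (\<lambda>r. g r (Y n)) - integral {0..s} (\<lambda>r. g r a) - G (Y n - a)) / norm (Y n - a)\<bar>)
        \<longlonglongrightarrow> \<bar>0\<bar>"
      by (intro tendsto_rabs) simp
    then show "((\<lambda>b. norm (integral {0..s} (\<lambda>r. g r b) - integral {0..s} (\<lambda>r. g r a) - G (b - a)) / norm (b - a)) \<circ> X)
        \<longlonglongrightarrow> 0"
      by - (rule LIMSEQ_offset[of _ N], simp add: Y_def o_def abs_divide)
  qed
  then show "((\<lambda>b. integral {0..s} (\<lambda>r. g r b)) has_derivative (\<lambda>h. integral {0..s} (\<lambda>r. g' r h))) (at a)"
    using bl unfolding has_derivative_iff_norm G_def[abs_def] by simp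
qed

section \<open>Area-preserving substitution\<close>

lemma area_preserving_integral:
  fixes f :: "real^2 \<Rightarrow> real^2"
  assumes q: "area_preserving q" "bij q" and f: "integrable lborel f"
  shows "integrable lborel (\<lambda>b. f (q b))" and "(LINT b|lborel. f (q b)) = (LINT y|lborel. f y)"
proof -
  note [measurable] = borel_measurable_integrable[OF f]
  define q' where "q' a = frechet_derivative q (at a)" for a
  have q': "(q has_derivative q' a) (at a)" and det: "det (matrix (q' a)) = 1" for a
    using q by (auto simp: area_preserving_def q'_def jacobian_def frechet_derivative_works)
  have "continuous_on UNIV q"
    using q' has_derivative_continuous by (blast intro: continuous_at_imp_continuous_on)
  then have [measurable]: "q \<in> borel_measurable borel" by (rule borel_measurable_continuous_onI)
  have meas: "(\<lambda>b. f (q b)) \<in> borel_measurable lborel" by simp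
  have f': "f absolutely_integrable_on UNIV" "integral UNIV f = (LINT y|lborel. f y)"
    using f has_integral_integral_lborel[OF f]
    by (auto simp: set_integrable_def integrable_completion dest: integral_unique)
  have "(\<lambda>b. \<bar>det (matrix (q' b))\<bar> *\<^sub>R f (q b)) absolutely_integrable_on UNIV \<and>
      integral UNIV (\<lambda>b. \<bar>det (matrix (q' b))\<bar> *\<^sub>R f (q b)) = (LINT y|lborel. f y)"
    using f' q(2) by (subst has_absolute_integral_change_of_variables[of UNIV q])
      (auto simp: bij_def q')
  then have *: "(\<lambda>b. f (q b)) absolutely_integrable_on UNIV"
      "integral UNIV (\<lambda>b. f (q b)) = (LINT y|lborel. f y)"
    by (simp_all add: det)
  show int: "integrable lborel (\<lambda>b. f (q b))"
    using *(1) meas by (simp add: set_integrable_def integrable_completion)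
  show "(LINT b|lborel. f (q b)) = (LINT y|lborel. f y)"
    using *(2) has_integral_integral_lborel[OF int] by (simp add: integral_unique)
qed

section \<open>The Lagrangian form of the equations\<close>

theorem mainTheorem5:
  fixes S :: real
    and \<omega> \<theta> B :: "real \<Rightarrow> real^2 \<Rightarrow> real"
    and \<omega>0 \<theta>0 :: "real^2 \<Rightarrow> real"
    and Q :: "real \<Rightarrow> real^2 \<Rightarrow> real^2"
  assumes "0 < S"
    and solution: "smooth_solution S \<omega> \<theta>"
    and initial: "\<And>x. \<omega> 0 x = \<omega>0 x" "\<And>x. \<theta> 0 x = \<theta>0 x"
    and supp_\<omega>0: "{b. \<omega>0 b \<noteq> 0} \<subseteq> cball 0 8"
    and supp_grad_\<theta>0: "{b. grad \<theta>0 b \<noteq> 0} \<subseteq> cball 0 8"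
    and Q_flow: "material_map S (velocity \<omega>) Q"
    and Q_area: "\<And>s. s \<in> {0..S} \<Longrightarrow> area_preserving (Q s)"
    and B_init: "\<And>a. B 0 a = 0"
    and B_deriv: "\<And>s a. s \<in> {0..S} \<Longrightarrow>
          ((\<lambda>r. B r a) has_real_derivative Q s a $ 1) (at s within {0..S})"
  shows "\<forall>s\<in>{0..S}. \<forall>a.
     \<theta> s (Q s a) = \<theta>0 a \<and>
     B s differentiable (at a) \<and>
     \<omega> s (Q s a) = \<omega>0 a + poisson_bracket (B s) \<theta>0 a \<and>
     set_integrable lborel (cball 0 8)
       (\<lambda>b. (\<omega>0 b + poisson_bracket (B s) \<theta>0 b) *\<^sub>R (K (Q s a - Q s b) - K (- Q s b))) \<and>
     ((\<lambda>r. Q r a) has_vector_derivative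
        (LINT b:cball 0 8|lborel.
           (\<omega>0 b + poisson_bracket (B s) \<theta>0 b) *\<^sub>R (K (Q s a - Q s b) - K (- Q s b))))
       (at s within {0..S}) \<and>
     ((\<lambda>r. B r a) has_real_derivative Q s a $ 1) (at s within {0..S})"
proof (intro ballI allI)
  fix s :: real and a :: "real^2" assume s: "s \<in> {0..S}"
  let ?v = "velocity \<omega>"
  have Q0: "Q 0 b = b" for b using Q_flow by (simp add: material_map_def)
  have Q_deriv: "((\<lambda>r. Q r b) has_vector_derivative ?v r (Q r b)) (at r within {0..S})"
    if "r \<in> {0..S}" for r b
    using Q_flow that by (simp add: material_map_def)
  have Q_cont: "continuous_on UNIV (Q r)" if "r \<in> {0..S}" for r
    using Q_area[OF that] differentiable_imp_continuous_within
    by (auto simp: area_preserving_def intro!: continuous_at_imp_continuous_on)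

  have \<theta>_const: "\<theta> r (Q r b) = \<theta>0 b" if r: "r \<in> {0..S}" for r b
  proof -
    have "((\<lambda>r. \<theta> r (Q r b)) has_vector_derivative 0) (at r within {0..S})" if "r \<in> {0..S}" for r
      using material_derivative[OF smooth_solutionD(2)[OF solution] \<open>0 < S\<close> that Q_deriv[OF that, of b]]
      by (simp add: smooth_solutionD(4)[OF solution that])
    then obtain c where c: "\<And>r. r \<in> {0..S} \<Longrightarrow> \<theta> r (Q r b) = c"
      using has_vector_derivative_zero_constant[of "{0..S}" "\<lambda>r. \<theta> r (Q r b)"] by auto
    show ?thesis using c[OF r] c[of 0] \<open>0 < S\<close> by (simp add: Q0 initial(2))
  qed

  \<comment> \<open>The source \<open>\<partial>\<^sub>2\<theta>\<close> seen by a particle is a bracket of labels.\<close>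
  have \<zeta>_deriv: "((\<lambda>r. \<omega> r (Q r b)) has_vector_derivative poisson_bracket (\<lambda>b. Q r b $ 1) \<theta>0 b)
      (at r within {0..S})" if r: "r \<in> {0..S}" for r b
  proof -
    obtain D where "\<And>s x. s \<in> {0..S} \<Longrightarrow>
        ((\<lambda>(s, x). \<theta> s x) has_derivative D (s, x)) (at (s, x) within {0..S} \<times> UNIV)"
      by (rule smooth_slabE[OF smooth_solutionD(2)[OF solution]]) blast
    from slab_derivative_space[OF this[OF r] r]
    have "partial 2 (\<theta> r) (Q r b) = poisson_bracket (\<lambda>b. Q r b $ 1) \<theta>0 b"
      by (rule partial_2_eq_bracket[OF Q_area[OF r]]) (simp add: \<theta>_const[OF r])
    then show ?thesis
      using material_derivative[OF smooth_solutionD(1)[OF solution] \<open>0 < S\<close> r Q_deriv[OF r, of b]]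
      by (simp add: smooth_solutionD(3)[OF solution r])
  qed

  have sub: "{0..s} \<subseteq> {0..S}" and s0: "0 \<le> s" using s by auto
  have B_integral: "((\<lambda>r. Q r b $ 1) has_integral B s b) {0..s}" for b
  proof -
    have "((\<lambda>r. Q r b $ 1) has_integral (B s b - B 0 b)) {0..s}"
    proof (rule fundamental_theorem_of_calculus[OF s0])
      show "((\<lambda>r. B r b) has_vector_derivative Q r b $ 1) (at r within {0..s})" if "r \<in> {0..s}" for r
        using has_vector_derivative_within_subset[OF
            B_deriv[unfolded has_real_derivative_iff_has_vector_derivative, of r b] sub] that sub by auto
    qed
    then show ?thesis by (simp add: B_init)
  qed
  have B_eq: "B s = (\<lambda>b. integral {0..s} (\<lambda>r. Q r b $ 1))"
    by (simp add: fun_eq_iff integral_unique[OF B_integral])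

  have B_derivative: "(\<lambda>r. frechet_derivative (Q r) (at b) h $ 1) integrable_on {0..s}"
    "(B s has_derivative (\<lambda>h. integral {0..s} (\<lambda>r. frechet_derivative (Q r) (at b) h $ 1))) (at b)" for b h
  proof -
    obtain L where L: "\<And>r x y. \<lbrakk>r \<in> {0..S}; norm x \<le> norm b + 1; norm y \<le> norm b + 1\<rbrakk> \<Longrightarrow>
        norm (Q r x - Q r y) \<le> L * norm (x - y)"
      by (rule flow_bilipschitz[OF solution Q_flow, of "norm b + 1"]) (rule that)
    have 1: "(\<lambda>r. Q r c $ 1) integrable_on {0..s}" for c
      using B_integral by blast
    have 2: "((\<lambda>b. Q r b $ 1) has_derivative (\<lambda>h. frechet_derivative (Q r) (at b) h $ 1)) (at b)"
      if "r \<in> {0..s}" for r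
      using Q_area[of r] that sub
      by (intro bounded_linear.has_derivative[OF bounded_linear_vec_nth])
        (auto simp: area_preserving_def frechet_derivative_works[symmetric])
    have 3: "\<bar>Q r c $ 1 - Q r b $ 1\<bar> \<le> L * norm (c - b)" if r: "r \<in> {0..s}" and c: "norm (c - b) \<le> 1" for r c
    proof -
      have "norm c \<le> norm b + 1" using c norm_triangle_sub[of c b] by linarith
      then have "norm (Q r c - Q r b) \<le> L * norm (c - b)" using L r sub by auto
      then show ?thesis using component_le_norm_cart[of "Q r c - Q r b" 1] by simp
    qed
    show "(\<lambda>r. frechet_derivative (Q r) (at b) h $ 1) integrable_on {0..s}"
      by (rule has_derivative_integral_Lipschitz(1)[OF 1 2 3])
    show "(B s has_derivative (\<lambda>h. integral {0..s} (\<lambda>r. frechet_derivative (Q r) (at b) h $ 1))) (at b)"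
      unfolding B_eq by (rule has_derivative_integral_Lipschitz(2)[OF 1 2 3])
  qed

  have \<zeta>: "\<omega> s (Q s b) = \<omega>0 b + poisson_bracket (B s) \<theta>0 b" for b
  proof -
    have gain: "((\<lambda>r. poisson_bracket (\<lambda>b. Q r b $ 1) \<theta>0 b) has_integral (\<omega> s (Q s b) - \<omega> 0 (Q 0 b))) {0..s}"
      by (rule fundamental_theorem_of_calculus[OF s0])
        (use has_vector_derivative_within_subset[OF \<zeta>_deriv sub] sub in auto)
    have bracket: "((\<lambda>r. poisson_bracket (\<lambda>b. Q r b $ 1) \<theta>0 b) has_integral poisson_bracket (B s) \<theta>0 b) {0..s}"
    proof -
      have p: "partial i (B s) b = integral {0..s} (\<lambda>r. frechet_derivative (Q r) (at b) (axis i 1) $ 1)" for i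
        by (rule partial_has_derivative[OF B_derivative(2)])
      have "((\<lambda>r. frechet_derivative (Q r) (at b) (axis 1 1) $ 1 * partial 2 \<theta>0 b
                - frechet_derivative (Q r) (at b) (axis 2 1) $ 1 * partial 1 \<theta>0 b)
            has_integral poisson_bracket (B s) \<theta>0 b) {0..s}"
        unfolding poisson_bracket_def p
        by (intro has_integral_diff has_integral_mult_left integrable_integral B_derivative(1))
      moreover have "partial i (\<lambda>b. Q r b $ 1) b = frechet_derivative (Q r) (at b) (axis i 1) $ 1"
        if "r \<in> {0..s}" for r i
        using Q_area[of r] that sub
        by (intro partial_has_derivative bounded_linear.has_derivative[OF bounded_linear_vec_nth])
          (auto simp: area_preserving_def frechet_derivative_works[symmetric])
      ultimately show ?thesis
        by (subst has_integral_cong) (auto simp: poisson_bracket_def)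
    qed
    show ?thesis
      using has_integral_unique[OF gain bracket] by (simp add: Q0 initial(1))
  qed

  have supp: "\<omega>0 b + poisson_bracket (B s) \<theta>0 b = 0" if "b \<notin> cball 0 8" for b
  proof -
    have "\<omega>0 b = 0" "grad \<theta>0 b = 0" using that supp_\<omega>0 supp_grad_\<theta>0 by auto
    moreover have "partial 1 \<theta>0 b = grad \<theta>0 b $ 1" "partial 2 \<theta>0 b = grad \<theta>0 b $ 2"
      by (simp_all add: grad_def)
    ultimately show ?thesis by (simp add: poisson_bracket_def)
  qed

  \<comment> \<open>Injectivity: trajectories do not meet. Surjectivity: bounded displacement.\<close>
  have bij: "bij (Q s)"
  proof (rule bijI)
    show "inj (Q s)"
    proof (rule injI)
      fix x y assume eq: "Q s x = Q s y"
      obtain L where L: "\<And>r b c. \<lbrakk>r \<in> {0..S}; norm b \<le> max (norm x) (norm y); norm c \<le> max (norm x) (norm y)\<rbrakk>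
          \<Longrightarrow> norm (b - c) \<le> L * norm (Q r b - Q r c)"
        by (rule flow_bilipschitz[OF solution Q_flow, of "max (norm x) (norm y)"]) (rule that)
      show "x = y" using L[OF s, of x y] eq by simp
    qed
    obtain C where C: "\<And>r b. r \<in> {0..S} \<Longrightarrow> norm (Q r b - b) \<le> C"
      by (rule flow_displacement[OF solution Q_flow]) (rule that)
    show "surj (Q s)" by (rule surj_bounded_displacement[OF Q_cont[OF s] C[OF s]])
  qed

  let ?F = "\<lambda>b. (\<omega>0 b + poisson_bracket (B s) \<theta>0 b) *\<^sub>R (K (Q s a - Q s b) - K (- Q s b))"
  obtain M where M: "\<And>r x. r \<in> {0..S} \<Longrightarrow> \<bar>\<omega> r x\<bar> \<le> M"
    "\<And>r. r \<in> {0..S} \<Longrightarrow> integrable lborel (\<omega> r)"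
    by (rule smooth_solution_boundE[OF solution]) (rule that)
  note K_int = K_conv_integrable[OF M(2)[OF s] M(1)[OF s]]
  have f_int: "integrable lborel (\<lambda>y. \<omega> s y *\<^sub>R (K (Q s a - y) - K (0 - y)))"
    using Bochner_Integration.integrable_diff[OF K_int[of "Q s a"] K_int[of 0]] by (simp add: scaleR_diff_right)
  \<comment> \<open>\<open>?F\<close> is the Biot--Savart integrand evaluated at \<open>y = Q(s, b)\<close>.\<close>
  have F: "?F = (\<lambda>b. \<omega> s (Q s b) *\<^sub>R (K (Q s a - Q s b) - K (0 - Q s b)))"
    by (simp add: \<zeta>)
  have F_int: "integrable lborel ?F"
    unfolding F by (rule area_preserving_integral(1)[OF Q_area[OF s] bij f_int])
  have F_ball: "(\<lambda>b. indicator (cball 0 8) b *\<^sub>R ?F b) = ?F"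
    by (rule ext) (use supp in \<open>auto simp: indicator_def\<close>)
  have v: "?v s (Q s a) = (LINT b:cball 0 8|lborel. ?F b)"
  proof -
    have "?v s (Q s a) = (LINT y|lborel. \<omega> s y *\<^sub>R (K (Q s a - y) - K (0 - y)))"
      using Bochner_Integration.integral_diff[OF K_int[of "Q s a"] K_int[of 0]]
      by (simp add: velocity_def K_conv_def scaleR_diff_right)
    also have "\<dots> = (LINT b|lborel. ?F b)"
      unfolding F by (rule area_preserving_integral(2)[OF Q_area[OF s] bij f_int, symmetric])
    finally show ?thesis
      unfolding set_lebesgue_integral_def F_ball .
  qed

  show "\<theta> s (Q s a) = \<theta>0 a \<and>
     B s differentiable (at a) \<and>
     \<omega> s (Q s a) = \<omega>0 a + poisson_bracket (B s) \<theta>0 a \<and>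
     set_integrable lborel (cball 0 8) ?F \<and>
     ((\<lambda>r. Q r a) has_vector_derivative (LINT b:cball 0 8|lborel. ?F b)) (at s within {0..S}) \<and>
     ((\<lambda>r. B r a) has_real_derivative Q s a $ 1) (at s within {0..S})"
  proof (intro conjI)
    show "set_integrable lborel (cball 0 8) ?F"
      unfolding set_integrable_def F_ball by (rule F_int)
    show "((\<lambda>r. Q r a) has_vector_derivative (LINT b:cball 0 8|lborel. ?F b)) (at s within {0..S})"
      using Q_deriv[OF s, of a] unfolding v .
    show "B s differentiable (at a)"
      using B_derivative(2) by (rule differentiableI)
  qed (fact \<theta>_const[OF s] \<zeta> B_deriv[OF s])+
qed

end
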